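(* For almost all $x\in(1,2)$ (with respect to Lebesgue measure), the set $\mathbf S_x=\{\lfloor x^n\rfloor : n\in\mathbb N\}$ is tail Sidon.
   Context: $\mathbb N$ denotes the positive integers. A set $A\subset\mathbb N$ is called a Sidon set if the equation $a+b=c+d$ has no non-trivial solutions in $A$, i.e. whenever $a,b,c,d\in A$ satisfy $a+b=c+d$, one has $\{a,b\}=\{c,d\}$. For real $x>1$, put $\mathbf S_x:=\{\lfloor x^n\rfloor : n\in\mathbb N\}$. The set $\mathbf S_x$ is called tail Sidon if there exists $N_0$ such that the set $\{\lfloor x^n\rfloor : n\ge N_0\}$ is a Sidon set. *)

theory Defs
  imports "HOL-Analysis.Analysis"
begin

definition sidon_set :: "nat set \<Rightarrow> bool" where
  "sidon_set A \<longleftrightarrow>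
     (\<forall>a\<in>A. \<forall>b\<in>A. \<forall>c\<in>A. \<forall>d\<in>A. a + b = c + d \<longrightarrow> {a, b} = {c, d})"

text \<open>
  The definitions below are meant for \<open>x > 1\<close>: then \<open>\<lfloor>x ^ n\<rfloor>\<close> is a positive integer, so the
  conversion from \<^typ>\<open>int\<close> by \<^const>\<open>nat\<close> loses nothing.  The set \<open>S\<^sub>x\<close> of all
  \<open>\<lfloor>x ^ n\<rfloor>\<close> with \<open>n\<close> a positive integer is \<open>floor_powers_from x 1\<close>.
\<close>

definition floor_powers_from :: "real \<Rightarrow> nat \<Rightarrow> nat set" where
  "floor_powers_from x N = {nat \<lfloor>x ^ n\<rfloor> | n. n \<ge> N}"

text \<open>
  The property of \<open>S\<^sub>x\<close> being tail Sidon, as a predicate of \<open>x\<close>, because it is phrased by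
  truncating the exponents.
\<close>

definition tail_sidon :: "real \<Rightarrow> bool" where
  "tail_sidon x \<longleftrightarrow> (\<exists>N\<^sub>0\<ge>1. sidon_set (floor_powers_from x N\<^sub>0))"

end

theory Submission
  imports Defs "HOL-Computational_Algebra.Polynomial"
begin

text \<open>
  Let \<open>x > 1\<close> and \<open>y = 1/x\<close>.  For large exponents a coincidence
  \<open>\<lfloor>x^a\<rfloor> + \<lfloor>x^b\<rfloor> = \<lfloor>x^c\<rfloor> + \<lfloor>x^d\<rfloor>\<close> with \<open>a > c \<ge> d\<close> forces \<open>d > b\<close>, and dividing by \<open>x^a\<close>
  yields \<open>\<bar>1 - y^p - y^q + y^r\<bar> < 2 y^a\<close> with \<open>1 \<le> p \<le> q < r\<close>.  Outside the countable set of
  those \<open>x\<close> for which some \<open>1 - y^p - y^q\<close> or \<open>1 - y^p - y^q + y^r\<close> vanishes, the left-hand side is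
  bounded below by a positive constant: it is at least \<open>(1 - y)/2\<close> once \<open>y^q \<le> (1 - y)/2\<close>, and for each
  of the finitely many remaining \<open>(p, q)\<close> it is a sequence in \<open>r\<close> of nonzero numbers with nonzero
  limit.  Hence \<open>a\<close> is bounded, and no Borel--Cantelli argument is needed.
\<close>

text \<open>The inverses converge to \<open>inverse L\<close>, hence are bounded by some
  \<open>K\<close>, and \<open>inverse K\<close> serves as \<open>e\<close>. As
  \<open>inverse 0 = 0\<close>, this bound says nothing where \<open>f\<close> vanishes.\<close>

lemma tendsto_nonzero_bounded_away:
  fixes f :: "nat \<Rightarrow> real"
  assumes "f \<longlonglongrightarrow> L" "L \<noteq> 0" "\<And>n. f n \<noteq> 0"
  shows "\<exists>e>0. \<forall>n. e \<le> \<bar>f n\<bar>"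
proof -
  obtain K where K: "K > 0" "\<And>n. norm (inverse (f n)) \<le> K"
    using Bfun_inverse[OF assms(1,2)] by (auto elim: BseqE)
  have "inverse K \<le> \<bar>f n\<bar>" for n
  proof -
    have "inverse \<bar>f n\<bar> \<le> K" using K(2)[of n] by simp
    then have "inverse K \<le> inverse (inverse \<bar>f n\<bar>)"
      using assms(3)[of n] by (intro le_imp_inverse_le) auto
    then show ?thesis by simp
  qed
  then show ?thesis using K(1) by (intro exI[of _ "inverse K"]) auto
qed

text \<open>The coefficient \<open>s\<close> is used with the values 0 and 1 only; it covers the two families at once.\<close>

definition quadrinomial_root :: "real \<Rightarrow> bool" where
  "quadrinomial_root y \<longleftrightarrow> (\<exists>p q r s :: nat. 1 \<le> p \<and> 1 \<le> q \<and> 1 \<le> r \<and> 1 - y ^ p - y ^ q + of_nat s * y ^ r = 0)"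

lemma countable_quadrinomial_roots: "countable {y. quadrinomial_root y}"
proof -
  define P :: "nat \<Rightarrow> nat \<Rightarrow> nat \<Rightarrow> nat \<Rightarrow> real poly" where
    \<comment> \<open>The shift by \<open>Suc\<close> keeps all three exponents positive, so the
      constant coefficient is 1 and no \<open>P p q r s\<close> is the zero polynomial.\<close>
    "P p q r s = 1 - monom 1 (Suc p) - monom 1 (Suc q) + monom (of_nat s) (Suc r)" for p q r s
  have "coeff (P p q r s) 0 = 1" for p q r s by (simp add: P_def)
  then have "P p q r s \<noteq> 0" for p q r s by (metis coeff_0 zero_neq_one)
  then have "countable {y. poly (P p q r s) y = 0}" for p q r s
    by (intro countable_finite poly_roots_finite)
  then have "countable (\<Union>p q r s. {y. poly (P p q r s) y = 0})"
    by (intro countable_UN) simp_all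
  moreover have "{y. quadrinomial_root y} \<subseteq> (\<Union>p q r s. {y. poly (P p q r s) y = 0})"
  proof
    fix y assume "y \<in> {y. quadrinomial_root y}"
    then obtain p q r s :: nat where *: "1 \<le> p" "1 \<le> q" "1 \<le> r"
      "1 - y ^ p - y ^ q + of_nat s * y ^ r = 0" by (auto simp: quadrinomial_root_def)
    then have "poly (P (p - 1) (q - 1) (r - 1) s) y = 0"
      by (simp add: P_def poly_monom)
    then show "y \<in> (\<Union>p q r s. {y. poly (P p q r s) y = 0})" by blast
  qed
  ultimately show ?thesis by (rule countable_subset[rotated])
qed

lemma quadrinomial_bounded_away:
  fixes y :: real
  assumes y: "0 < y" "y < 1" and nz: "\<not> quadrinomial_root y"
  shows "\<exists>e>0. \<forall>p q r. 1 \<le> p \<and> p \<le> q \<and> q < r \<longrightarrow> e \<le> \<bar>1 - y ^ p - y ^ q + y ^ r\<bar>"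
proof -
  have nz': "1 - y ^ p - y ^ q + of_nat s * y ^ r \<noteq> 0" if "1 \<le> p" "1 \<le> q" "1 \<le> r" for p q r s :: nat
    using nz that unfolding quadrinomial_root_def by blast
  have "\<exists>e>0. \<forall>r. e \<le> \<bar>1 - y ^ p - y ^ q + y ^ Suc r\<bar>" if "1 \<le> p" "1 \<le> q" for p q
  proof (rule tendsto_nonzero_bounded_away)
    have "(\<lambda>r. y ^ Suc r) \<longlonglongrightarrow> 0"
      by (rule LIMSEQ_Suc, rule LIMSEQ_power_zero) (use y in simp)
    then show "(\<lambda>r. 1 - y ^ p - y ^ q + y ^ Suc r) \<longlonglongrightarrow> 1 - y ^ p - y ^ q"
      using tendsto_add[OF tendsto_const[of "1 - y ^ p - y ^ q"]] by fastforce
    \<comment> \<open>The limit is the case \<open>s = 0\<close>, with a dummy exponent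
      \<open>r = 1\<close>.\<close>
    show "1 - y ^ p - y ^ q \<noteq> 0" using nz'[OF that, of 1 0] by simp
    show "1 - y ^ p - y ^ q + y ^ Suc r \<noteq> 0" for r using nz'[OF that, of "Suc r" 1] by simp
  qed
  then obtain E where E: "\<And>p q. 1 \<le> p \<Longrightarrow> 1 \<le> q \<Longrightarrow> 0 < E p q"
    "\<And>p q r. 1 \<le> p \<Longrightarrow> 1 \<le> q \<Longrightarrow> E p q \<le> \<bar>1 - y ^ p - y ^ q + y ^ Suc r\<bar>"
    by metis
  \<comment> \<open>Beyond \<open>Q\<close>, the bounds \<open>1 - y ^ p \<ge> 1 - y\<close> and
    \<open>y ^ q < (1 - y) / 2\<close> suffice; up to \<open>Q\<close>, only finitely many
    \<open>E p q\<close> matter.\<close>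
  obtain Q where Q: "y ^ Q < (1 - y) / 2"
    using real_arch_pow_inv[of "(1 - y) / 2" y] y by auto
  define S where "S = insert ((1 - y) / 2) (case_prod E ` ({1..Q} \<times> {1..Q}))"
  have fin: "finite S" and ne: "S \<noteq> {}" by (auto simp: S_def)
  have pos: "0 < Min S" using fin ne y E(1) by (subst Min_gr_iff) (auto simp: S_def)
  have "Min S \<le> \<bar>1 - y ^ p - y ^ q + y ^ r\<bar>" if pqr: "1 \<le> p" "p \<le> q" "q < r" for p q r
  proof (cases "q \<le> Q")
    case True
    then have "E p q \<in> S" using pqr by (force simp: S_def)
    then have "Min S \<le> E p q" using fin by simp
    also have "\<dots> \<le> \<bar>1 - y ^ p - y ^ q + y ^ r\<bar>"
      using E(2)[of p q "r - 1"] pqr by simp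
    finally show ?thesis .
  next
    case False
    have "y ^ p \<le> y" using power_decreasing[of 1 p y] y pqr by simp
    moreover have "y ^ q \<le> y ^ Q" using power_decreasing[of Q q y] y False by simp
    moreover have "0 < y ^ r" using y by simp
    moreover have "Min S \<le> (1 - y) / 2" using fin by (intro Min_le) (auto simp: S_def)
    ultimately show ?thesis using Q by (simp add: field_simps)
  qed
  with pos show ?thesis by blast
qed

text \<open>From exponent \<open>N\<close> on, consecutive powers differ by
  \<open>x ^ m * (x - 1) \<ge> 1\<close>, which separates their floors.\<close>

lemma floor_power_less:
  fixes x :: real
  assumes x: "1 < x" and N: "1 \<le> x ^ N * (x - 1)" and "N \<le> m" "m < n"
  shows "nat \<lfloor>x ^ m\<rfloor> < nat \<lfloor>x ^ n\<rfloor>"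
proof -
  have "1 \<le> x ^ m * (x - 1)"
    using N mult_right_mono[OF power_increasing[OF \<open>N \<le> m\<close>, of x], of "x - 1"] x by linarith
  then have "x ^ m + 1 \<le> x ^ Suc m" by (simp add: algebra_simps)
  also have "\<dots> \<le> x ^ n" using x \<open>m < n\<close> by (intro power_increasing) auto
  finally have "\<lfloor>x ^ m\<rfloor> < \<lfloor>x ^ n\<rfloor>" by linarith
  moreover have "0 \<le> \<lfloor>x ^ m\<rfloor>" using x by simp
  ultimately show ?thesis by linarith
qed

lemma tail_sidon_if_not_quadrinomial_root:
  assumes x: "1 < x" and nz: "\<not> quadrinomial_root (inverse x)"
  shows "tail_sidon x"
proof -
  define y where "y = inverse x"
  have y: "0 < y" "y < 1" using x by (auto simp: y_def inverse_less_1_iff)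
  obtain e where e: "e > 0"
    "\<And>p q r. 1 \<le> p \<Longrightarrow> p \<le> q \<Longrightarrow> q < r \<Longrightarrow> e \<le> \<bar>1 - y ^ p - y ^ q + y ^ r\<bar>"
    using quadrinomial_bounded_away[OF y] nz unfolding y_def by blast
  \<comment> \<open>The first summand makes the floors strictly increasing from \<open>N\<close> on;
    the second makes \<open>x ^ N * e\<close> exceed the total rounding error 2.\<close>
  obtain N0 where N0: "1 / (x - 1) + 2 / e < x ^ N0" using real_arch_pow[OF x] by blast
  define N where "N = Suc N0"
  have "x ^ N0 \<le> x ^ N" using x unfolding N_def by (intro power_increasing) auto
  with N0 have big: "1 / (x - 1) + 2 / e < x ^ N" by linarith
  have "0 < 1 / (x - 1)" "0 < 2 / e" using x e by auto
  with big have "1 / (x - 1) < x ^ N" "2 / e < x ^ N" by linarith+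
  then have N: "1 \<le> x ^ N * (x - 1)" "2 < x ^ N * e"
    using x e by (simp_all add: field_simps)
  define F where "F n = nat \<lfloor>x ^ n\<rfloor>" for n
  have mono: "F m < F n" if "N \<le> m" "m < n" for m n
    unfolding F_def using floor_power_less[OF x N(1) that] .
  have inj: "m = n" if "F m = F n" "N \<le> m" "N \<le> n" for m n
    using that mono[of m n] mono[of n m] by linarith
  have F: "real (F n) \<le> x ^ n" "x ^ n < real (F n) + 1" for n
  proof -
    have "0 \<le> \<lfloor>x ^ n\<rfloor>" using x by simp
    then have "real (F n) = of_int \<lfloor>x ^ n\<rfloor>" by (simp add: F_def)
    then show "real (F n) \<le> x ^ n" "x ^ n < real (F n) + 1" by linarith+
  qed
  have core: False
    if eq: "F a + F b = F c + F d" and ge: "N \<le> a" "N \<le> b" "N \<le> c" "N \<le> d" and "d \<le> c" "c < a"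
    for a b c d
  proof -
    have "F b < F d" using mono[OF ge(3) \<open>c < a\<close>] eq by linarith
    then have "b < d" using mono[of d b] ge by (metis less_asym' linorder_neqE_nat less_irrefl)
    have quot: "x ^ a * y ^ (a - k) = x ^ k" if "k \<le> a" for k
      using x that by (simp add: y_def power_inverse power_diff field_simps)
    \<comment> \<open>The bound \<open>e\<close> is applied with \<open>p = a - c\<close>,
      \<open>q = a - d\<close> and \<open>r = a - b\<close>; here \<open>b < d\<close> gives
      \<open>q < r\<close>.\<close>
    have "x ^ N * e \<le> x ^ a * \<bar>1 - y ^ (a - c) - y ^ (a - d) + y ^ (a - b)\<bar>"
      using x e ge \<open>b < d\<close> \<open>d \<le> c\<close> \<open>c < a\<close>
      by (intro mult_mono power_increasing e(2)) auto
    also have "\<dots> = \<bar>x ^ a * (1 - y ^ (a - c) - y ^ (a - d) + y ^ (a - b))\<bar>"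
      using x by (simp add: abs_mult)
    also have "x ^ a * (1 - y ^ (a - c) - y ^ (a - d) + y ^ (a - b)) = x ^ a - x ^ c - x ^ d + x ^ b"
      using \<open>b < d\<close> \<open>d \<le> c\<close> \<open>c < a\<close> by (simp add: distrib_left right_diff_distrib quot)
    also have "\<bar>x ^ a - x ^ c - x ^ d + x ^ b\<bar> < 2"
    proof -
      \<comment> \<open>The floors cancel, leaving two rounding errors from \<open>[0, 1)\<close>
        with each sign.\<close>
      have "real (F a) + real (F b) = real (F c) + real (F d)" using eq by (metis of_nat_add)
      then show ?thesis using F[of a] F[of b] F[of c] F[of d] by linarith
    qed
    finally show False using N(2) by linarith
  qed
  \<comment> \<open>Swapping indices within either side brings any counterexample into the form
    excluded by \<open>core\<close>.\<close>
  have max_le: "max a b \<le> max c d"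
    if "F a + F b = F c + F d" "N \<le> a" "N \<le> b" "N \<le> c" "N \<le> d" for a b c d
    using core[of a b c d] core[of b a c d] core[of a b d c] core[of b a d c] that
    by (smt (verit) add.commute max_def nat_le_linear not_le)
  have "sidon_set (floor_powers_from x N)"
  proof -
    have "{F a, F b} = {F c, F d}"
      if eq: "F a + F b = F c + F d" and ge: "N \<le> a" "N \<le> b" "N \<le> c" "N \<le> d" for a b c d
    proof -
      have "max a b = max c d"
        using max_le[OF eq ge] max_le[OF eq[symmetric] ge(3,4,1,2)] by (rule antisym)
      \<comment> \<open>Equal maxima give the two sides a common index, and cancelling its term
        equates the other two.\<close>
      then consider "a = c" | "a = d" | "b = c" | "b = d" by (metis max_def)
      then show ?thesis using eq by cases auto
    qed
    then show ?thesis unfolding sidon_set_def floor_powers_from_def F_def by blast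
  qed
  then show ?thesis unfolding tail_sidon_def N_def by (intro exI[of _ "Suc N0"]) auto
qed

theorem theorem2p1:
  shows "AE x\<in>{1<..<2} in lebesgue. tail_sidon x"
proof (rule AE_I')
  have "{x. quadrinomial_root (inverse x)} \<subseteq> inverse ` {y. quadrinomial_root y}"
    by (metis (mono_tags) image_iff inverse_inverse_eq mem_Collect_eq subsetI)
  then have "countable {x. quadrinomial_root (inverse x)}"
    using countable_quadrinomial_roots countable_image countable_subset by blast
  then show "{x. quadrinomial_root (inverse x)} \<in> null_sets lebesgue"
    by (intro null_sets_completionI countable_imp_null_set_lborel)
  show "{x \<in> space lebesgue. \<not> (x \<in> {1<..<2} \<longrightarrow> tail_sidon x)} \<subseteq> {x. quadrinomial_root (inverse x)}"
    using tail_sidon_if_not_quadrinomial_root by auto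
qed

end
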